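(* Let $M=\{1^{p_1},2^{p_2},\dots,n^{p_n}\}$ with $p_1,\dots,p_n$ positive integers and $p=\sum_{i=1}^np_i$. Then $$\hat S_M(x,y,z):=\sum_{T\in\mathcal{T}_M}x^{\lfloor\mathsf{ee}(T)/2\rfloor}y^{\lfloor\mathsf{oe}(T)/2\rfloor}z^{\lfloor\mathsf{odd}(T)/2\rfloor}=\sum_i x^i\sum_j\hat\gamma_{M,i,j}\,(yz)^j(y+z)^{\lfloor p/2\rfloor-i-2j},$$ where $\hat\gamma_{M,i,j}$ is the number of trees $T\in\mathcal{T}_M$ with $\lfloor\mathsf{ee}(T)/2\rfloor=i$, $\mathsf{act}(T)=\lfloor p/2\rfloor-i-2j$ and $\mathsf{eact}(T)=0$. Consequently, $\hat S_M(x,y,z)$ is symmetric in $y$ and $z$, and if $\hat S_M(x,y,z)=\sum_i x^i\hat S_{M,i}(y,z)$, then $\hat S_{M,i}(y,1)=\hat S_{M,i}(1,y)$ is palindromic and unimodal.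
   Context: A plane tree is a rooted tree in which the children of every node are linearly ordered (left to right). A weakly increasing tree on $M$ is a plane tree with $p+1$ nodes labeled by the elements of the multiset $M\cup\{0\}$ (with multiplicity) such that labels weakly increase along every root-to-leaf path and the labels of the children of each node weakly increase from left to right. $\mathcal{T}_M$ is the set of such trees. The degree of a node is its number of children; the level of a node is its distance from the root (root at level $0$). $\mathsf{ee}(T)$, $\mathsf{oe}(T)$ are the numbers of even-degree nodes on even, resp. odd, levels; $\mathsf{odd}(T)$ is the number of odd-degree nodes. Active nodes: let $u$ be a node of $T$ and let $y$ be the first sibling to the right of $u$ (possibly nonexistent). $u$ is active if (a) the level of $u$ is odd; (b) $u$ is the $k$-th child from the left of its parent with $k$ odd; and (c) either $y$ exists and the degrees of $u$ and $y$ have the same parity, or $y$ does not exist and the degree of $u$ is odd. An active node is active even or active odd according to the parity of its degree. $\mathsf{act}(T)$ is the number of active nodes and $\mathsf{eact}(T)$ the number of active even nodes of $T$. *)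

theory Defs
  imports "HOL-Library.Multiset" "HOL-Computational_Algebra.Polynomial"
begin

datatype ptree = Node (label: nat) (children: "ptree list")

fun labels :: "ptree \<Rightarrow> nat multiset" where
  "labels (Node a ts) = add_mset a (\<Sum>t\<leftarrow>ts. labels t)"

fun weakly_increasing :: "ptree \<Rightarrow> bool" where
  "weakly_increasing (Node a ts) \<longleftrightarrow>
     sorted (map label ts) \<and> (\<forall>t\<in>set ts. a \<le> label t \<and> weakly_increasing t)"

definition wi_trees :: "nat multiset \<Rightarrow> ptree set" where
  "wi_trees M = {T. weakly_increasing T \<and> labels T = add_mset 0 M}"

text \<open>A node is identified with its address: the sequence of 0-based child positions on the way
  from the root. Its level is the length of the address, and an address ending in \<open>k\<close>
  belongs to the \<open>(k+1)\<close>-th child of the parent.\<close>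

fun is_node :: "ptree \<Rightarrow> nat list \<Rightarrow> bool" where
  "is_node T [] \<longleftrightarrow> True"
| "is_node T (k # u) \<longleftrightarrow> k < length (children T) \<and> is_node (children T ! k) u"

definition nodes :: "ptree \<Rightarrow> nat list set" where
  "nodes T = {u. is_node T u}"

fun subtree :: "ptree \<Rightarrow> nat list \<Rightarrow> ptree" where
  "subtree T [] = T"
| "subtree T (k # u) = subtree (children T ! k) u"

definition deg :: "ptree \<Rightarrow> nat list \<Rightarrow> nat" where
  "deg T u = length (children (subtree T u))"

abbreviation level :: "nat list \<Rightarrow> nat" where
  "level u \<equiv> length u"

definition ee :: "ptree \<Rightarrow> nat" where
  "ee T = card {u \<in> nodes T. even (level u) \<and> even (deg T u)}"

definition oe :: "ptree \<Rightarrow> nat" where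
  "oe T = card {u \<in> nodes T. odd (level u) \<and> even (deg T u)}"

definition odd_nodes :: "ptree \<Rightarrow> nat" where
  "odd_nodes T = card {u \<in> nodes T. odd (deg T u)}"

definition right_sibling :: "nat list \<Rightarrow> nat list" where
  "right_sibling u = butlast u @ [Suc (last u)]"

text \<open>Positions being 0-based, being the \<open>k\<close>-th child with \<open>k\<close> odd means \<open>even (last u)\<close>.\<close>

definition active :: "ptree \<Rightarrow> nat list \<Rightarrow> bool" where
  "active T u \<longleftrightarrow> u \<in> nodes T \<and> odd (level u) \<and> even (last u) \<and>
     (if right_sibling u \<in> nodes T
      then even (deg T u) \<longleftrightarrow> even (deg T (right_sibling u))
      else odd (deg T u))"

definition act :: "ptree \<Rightarrow> nat" where
  "act T = card {u. active T u}"

definition eact :: "ptree \<Rightarrow> nat" where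
  "eact T = card {u. active T u \<and> even (deg T u)}"

definition S_hat :: "nat multiset \<Rightarrow> 'a \<Rightarrow> 'a \<Rightarrow> 'a \<Rightarrow> 'a::comm_semiring_1" where
  "S_hat M x y z =
     (\<Sum>T\<in>wi_trees M. x ^ (ee T div 2) * y ^ (oe T div 2) * z ^ (odd_nodes T div 2))"

text \<open>The equation is over the integers, so that there are no trees to count when
  \<open>i + 2 * j\<close> exceeds \<open>size M div 2\<close>.\<close>

definition gamma_hat :: "nat multiset \<Rightarrow> nat \<Rightarrow> nat \<Rightarrow> nat" where
  "gamma_hat M i j = card {T \<in> wi_trees M. ee T div 2 = i \<and>
     int (act T) = int (size M div 2) - int i - 2 * int j \<and> eact T = 0}"

text \<open>The polynomial ring in three indeterminates is \<open>\<int>[z][y][x]\<close>: the outermost variable is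
  \<open>x\<close>, so that coefficients with respect to \<open>x\<close> are polynomials in \<open>y\<close> and \<open>z\<close>.\<close>

definition X :: "int poly poly poly" where "X = [:0, 1:]"
definition Y :: "int poly poly poly" where "Y = [:[:0, 1:]:]"
definition Z :: "int poly poly poly" where "Z = [:[:[:0, 1:]:]:]"

definition S_hat_coeff :: "nat multiset \<Rightarrow> nat \<Rightarrow> int poly poly" where
  "S_hat_coeff M i = coeff (S_hat M X Y Z) i"

definition eval_yz :: "int poly poly \<Rightarrow> 'a \<Rightarrow> 'a \<Rightarrow> 'a::comm_ring_1" where
  "eval_yz q b c = poly (map_poly (\<lambda>r. poly (map_poly of_int r) c) q) b"

definition palindromic :: "int poly \<Rightarrow> bool" where
  "palindromic h \<longleftrightarrow> (\<forall>k\<le>degree h. coeff h k = coeff h (degree h - k))"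

definition unimodal :: "int poly \<Rightarrow> bool" where
  "unimodal h \<longleftrightarrow> (\<exists>m\<le>degree h.
     (\<forall>k<m. coeff h k \<le> coeff h (Suc k)) \<and>
     (\<forall>k. m \<le> k \<and> k < degree h \<longrightarrow> coeff h (Suc k) \<le> coeff h k))"

lemma finite_nodes: "finite (nodes T)"
proof (induction T)
  case (Node a ts)
  have "nodes (Node a ts) \<subseteq> insert [] (\<Union>k<length ts. (#) k ` nodes (ts ! k))"
  proof
    fix u assume "u \<in> nodes (Node a ts)"
    then show "u \<in> insert [] (\<Union>k<length ts. (#) k ` nodes (ts ! k))"
      by (cases u) (auto simp: nodes_def)
  qed
  moreover have "finite (\<Union>k<length ts. (#) k ` nodes (ts ! k))"
    using Node by auto
  ultimately show ?case
    by (meson finite_insert finite_subset)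
qed

lemma finite_labels_subset: "finite {T. labels T \<subseteq># N}"
proof (induction "size N" arbitrary: N rule: less_induct)
  case less
  let ?S = "\<Union>a\<in>set_mset N. {t. labels t \<subseteq># N - {#a#}}"
  have fin: "finite ?S"
    by (auto intro!: less size_Diff1_less)
  have len: "length ts \<le> size (\<Sum>t\<leftarrow>ts. labels t)" for ts
  proof (induction ts)
    case (Cons t ts)
    then show ?case by (cases t) auto
  qed simp
  have mem: "labels t \<subseteq># (\<Sum>t\<leftarrow>ts. labels t)" if "t \<in> set ts" for t ts
    using that by (induction ts) (auto intro: subset_mset.add_increasing subset_mset.add_increasing2)
  have "{T. labels T \<subseteq># N} \<subseteq>
      (\<lambda>(a, ts). Node a ts) ` (set_mset N \<times> {ts. set ts \<subseteq> ?S \<and> length ts \<le> size N})"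
  proof
    fix T assume "T \<in> {T. labels T \<subseteq># N}"
    moreover obtain a ts where T: "T = Node a ts" by (cases T)
    ultimately have sub: "add_mset a (\<Sum>t\<leftarrow>ts. labels t) \<subseteq># N" by simp
    then have a: "a \<in># N" and rest: "(\<Sum>t\<leftarrow>ts. labels t) \<subseteq># N - {#a#}"
      by (auto simp: insert_subset_eq_iff)
    have "length ts \<le> size N"
      using len[of ts] size_mset_mono[OF sub] by simp
    moreover have "set ts \<subseteq> ?S"
      using a rest mem subset_mset.order_trans by blast
    ultimately show "T \<in> (\<lambda>(a, ts). Node a ts) `
        (set_mset N \<times> {ts. set ts \<subseteq> ?S \<and> length ts \<le> size N})"
      using a T by auto
  qed
  moreover have "finite (set_mset N \<times> {ts. set ts \<subseteq> ?S \<and> length ts \<le> size N})"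
    using fin finite_lists_length_le by blast
  ultimately show ?case
    by (meson finite_imageI finite_subset)
qed

lemma finite_wi_trees: "finite (wi_trees M)"
  by (rule finite_subset[OF _ finite_labels_subset[of "add_mset 0 M"]]) (auto simp: wi_trees_def)

end

theory Submission
  imports Defs
begin

text \<open>
  Grouping the children of every even-level node into consecutive pairs shows that
  \<open>odd_nodes T - oe T = 2 * (act T - 2 * eact T)\<close>. Together with the parity of the degree sum, this
  makes the monomial of \<open>T\<close> equal to \<open>x\<^sup>i y\<^sup>j\<^sup>+\<^sup>e z\<^sup>j\<^sup>+\<^sup>a\<^sup>-\<^sup>e\<close> with \<open>a = act T\<close>, \<open>e = eact T\<close> and
  \<open>i + 2 * j + a = p div 2\<close>. So it suffices that, for fixed \<open>i\<close> and \<open>a\<close>, the number of trees with \<open>e\<close>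
  active even nodes is \<open>a choose e\<close> times the number of those with none. This follows by double
  counting from an involution on pairs of a tree and a marked active node \<open>u\<close>, which switches the
  parity of the degree of \<open>u\<close> and preserves \<open>ee\<close> and \<open>act\<close>.

  If \<open>u\<close> has a right sibling \<open>y\<close>, the involution moves a child from one of them to the other. The
  exception occurs when \<open>y\<close> is a leaf and every label \<open>\<ge> label y\<close> occurs evenly often among the
  children of \<open>u\<close>: then \<open>y\<close> becomes a child of \<open>u\<close> and adopts all its former right siblings. These
  are exactly the configurations that match an odd active node without a right sibling.

  Palindromicity refers to the actual degree, so one needs \<open>gamma_hat M i 0 > 0\<close> whenever the
  coefficient of \<open>x\<^sup>i\<close> is nonzero; a path ending in a star witnesses this.
\<close>

section \<open>Recursive description of the statistics\<close>

definition degs :: "ptree list \<Rightarrow> nat list" where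
  "degs D = map (\<lambda>t. length (children t)) D"

lemma degs_simps [simp]:
  "degs [] = []" "degs (t # D) = length (children t) # degs D"
  "degs (D @ E) = degs D @ degs E" "length (degs D) = length D"
  by (simp_all add: degs_def)

lemma nth_degs [simp]: "k < length D \<Longrightarrow> degs D ! k = length (children (D ! k))"
  by (simp add: degs_def)

lemma drop_degs: "drop k (degs D) = degs (drop k D)"
  by (simp add: degs_def drop_map)

lemma sum_list_nth: "(\<Sum>x\<leftarrow>xs. f x) = (\<Sum>k<length xs. f (xs ! k))"
  for f :: "'a \<Rightarrow> 'b::comm_monoid_add"
  by (simp add: sum_list_sum_nth atLeast0LessThan)

text \<open>The statistics depend on the parity of levels, so the recursion descends two levels at a
  time: a grandchild of the root sits at an even level, and the assumption says that
  \<open>Q\<close> on addresses below it only sees its own subtree.\<close>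

lemma card_nodes_Node:
  assumes "\<And>k j v. k < length D \<Longrightarrow> j < length (children (D ! k)) \<Longrightarrow>
    Q (Node a D) (k # j # v) \<longleftrightarrow> Q (children (D ! k) ! j) v"
  shows "card {u \<in> nodes (Node a D). Q (Node a D) u} =
    of_bool (Q (Node a D) []) + card {k. k < length D \<and> Q (Node a D) [k]} +
    (\<Sum>u\<leftarrow>D. \<Sum>c\<leftarrow>children u. card {v \<in> nodes c. Q c v})"
proof -
  let ?T = "Node a D"
  let ?c = "\<lambda>k j. children (D ! k) ! j"
  let ?B = "\<lambda>k j. (\<lambda>v. k # j # v) ` {v \<in> nodes (?c k j). Q (?c k j) v}"
  let ?A0 = "{u :: nat list. u = [] \<and> Q ?T []}" and ?A1 = "(\<lambda>k. [k]) ` {k. k < length D \<and> Q ?T [k]}"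
  let ?A2 = "\<Union>k<length D. \<Union>j<length (children (D ! k)). ?B k j"
  have split: "{u \<in> nodes ?T. Q ?T u} = ?A0 \<union> ?A1 \<union> ?A2"
  proof (rule set_eqI)
    fix u
    show "u \<in> {u \<in> nodes ?T. Q ?T u} \<longleftrightarrow> u \<in> ?A0 \<union> ?A1 \<union> ?A2"
    proof (cases u)
      case Nil
      then show ?thesis by (auto simp: nodes_def)
    next
      case (Cons k w)
      then show ?thesis by (cases w) (auto simp: nodes_def assms image_iff)
    qed
  qed
  have fB: "finite (?B k j)" for k j by (simp add: finite_nodes)
  have c2: "card ?A2 = (\<Sum>k<length D. \<Sum>j<length (children (D ! k)).
      card {v \<in> nodes (?c k j). Q (?c k j) v})"
  proof -
    have "card ?A2 = (\<Sum>k<length D. card (\<Union>j<length (children (D ! k)). ?B k j))"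
      by (rule card_UN_disjoint) (auto simp: fB)
    also have "\<dots> = (\<Sum>k<length D. \<Sum>j<length (children (D ! k)). card (?B k j))"
      by (intro sum.cong refl card_UN_disjoint) (auto simp: fB)
    also have "\<dots> = (\<Sum>k<length D. \<Sum>j<length (children (D ! k)).
        card {v \<in> nodes (?c k j). Q (?c k j) v})"
      by (intro sum.cong refl card_image) (auto simp: inj_on_def)
    finally show ?thesis .
  qed
  have f2: "finite ?A2" using fB by blast
  have c1: "card ?A1 = card {k. k < length D \<and> Q ?T [k]}"
    by (rule card_image) (auto simp: inj_on_def)
  have c0: "card ?A0 = of_bool (Q ?T [])" by (cases "Q ?T []") auto
  have "card (?A0 \<union> ?A1 \<union> ?A2) = card (?A0 \<union> ?A1) + card ?A2"
    by (rule card_Un_disjoint) (use f2 in auto)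
  moreover have "card (?A0 \<union> ?A1) = card ?A0 + card ?A1"
    by (rule card_Un_disjoint) auto
  ultimately show ?thesis
    using split c0 c1 c2 by (simp add: sum_list_nth)
qed

text \<open>Condition (c) of activity for the first of a list of siblings, read off from the degrees
  of that node and everything to its right.\<close>

fun active_head :: "nat list \<Rightarrow> bool" where
  "active_head [] \<longleftrightarrow> False"
| "active_head [d] \<longleftrightarrow> odd d"
| "active_head (d # d' # ds) \<longleftrightarrow> even d = even d'"

fun act_pairs :: "nat list \<Rightarrow> nat" where
  "act_pairs [] = 0"
| "act_pairs [d] = of_bool (odd d)"
| "act_pairs (d # d' # ds) = of_bool (even d = even d') + act_pairs ds"

fun eact_pairs :: "nat list \<Rightarrow> nat" where
  "eact_pairs [] = 0"
| "eact_pairs [d] = 0"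
| "eact_pairs (d # d' # ds) = of_bool (even d \<and> even d') + eact_pairs ds"

lemma card_even_positions_Cons2:
  "card {k. k < length (d # d' # ds) \<and> even k \<and> P (drop k (d # d' # ds))} =
   of_bool (P (d # d' # ds)) + card {k. k < length ds \<and> even k \<and> P (drop k ds)}"
proof -
  let ?B = "(\<lambda>k. Suc (Suc k)) ` {k. k < length ds \<and> even k \<and> P (drop k ds)}"
  have "{k. k < length (d # d' # ds) \<and> even k \<and> P (drop k (d # d' # ds))} =
      {k. k = 0 \<and> P (d # d' # ds)} \<union> ?B" (is "?L = ?A \<union> _")
  proof (rule set_eqI)
    fix k
    consider "k = 0" | "k = 1" | j where "k = Suc (Suc j)"
      by (metis One_nat_def nat.exhaust)
    then show "k \<in> ?L \<longleftrightarrow> k \<in> ?A \<union> ?B" by cases auto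
  qed
  moreover have "card (?A \<union> ?B) = card ?A + card ?B"
    by (rule card_Un_disjoint) auto
  moreover have "card ?B = card {k. k < length ds \<and> even k \<and> P (drop k ds)}"
    by (rule card_image) (simp add: inj_on_def)
  moreover have "card ?A = of_bool (P (d # d' # ds))" by (cases "P (d # d' # ds)") auto
  ultimately show ?thesis by simp
qed

lemma card_active_head:
  "card {k. k < length ds \<and> even k \<and> active_head (drop k ds)} = act_pairs ds"
proof (induction ds rule: act_pairs.induct)
  case (2 d)
  have "{k. k < length [d] \<and> even k \<and> active_head (drop k [d])} = (if odd d then {0} else {})"
    by (auto simp: less_Suc_eq)
  then show ?case by simp
next
  case (3 d d' ds)
  then show ?case by (subst card_even_positions_Cons2) simp
qed simp

lemma card_even_active_head:
  "card {k. k < length ds \<and> even k \<and> (active_head (drop k ds) \<and> even (hd (drop k ds)))} =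
   eact_pairs ds"
proof (induction ds rule: eact_pairs.induct)
  case (2 d)
  have "{k. k < length [d] \<and> even k \<and> (active_head (drop k [d]) \<and> even (hd (drop k [d])))} = {}"
    by (auto simp: less_Suc_eq)
  then show ?case by (simp only: card.empty eact_pairs.simps)
next
  case (3 d d' ds)
  then show ?case
    by (subst card_even_positions_Cons2[where P = "\<lambda>ds. active_head ds \<and> even (hd ds)"]) auto
qed simp

lemma nodes_singleton [simp]: "[k] \<in> nodes (Node a D) \<longleftrightarrow> k < length D"
  by (simp add: nodes_def)

lemma nodes_Cons2 [simp]: "k # j # v \<in> nodes (Node a D) \<longleftrightarrow>
    k < length D \<and> j < length (children (D ! k)) \<and> v \<in> nodes (children (D ! k) ! j)"
  by (simp add: nodes_def)

lemma deg_simps [simp]: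
  "deg (Node a D) [] = length D"
  "deg (Node a D) [k] = length (children (D ! k))"
  "deg (Node a D) (k # j # v) = deg (children (D ! k) ! j) v"
  by (simp_all add: deg_def)

lemma active_singleton:
  "active (Node a D) [k] \<longleftrightarrow> k < length D \<and> even k \<and> active_head (degs (drop k D))"
proof (cases "k < length D")
  case True
  then have *: "drop k D = D ! k # drop (Suc k) D" by (simp add: Cons_nth_drop_Suc)
  show ?thesis
  proof (cases "Suc k < length D")
    case True
    then have "drop (Suc k) D = D ! Suc k # drop (Suc (Suc k)) D"
      by (simp add: Cons_nth_drop_Suc)
    with * True show ?thesis by (simp add: active_def right_sibling_def)
  next
    case False
    with * \<open>k < length D\<close> show ?thesis by (simp add: active_def right_sibling_def)
  qed
qed (simp add: active_def)

lemma active_Cons2: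
  assumes "k < length D" "j < length (children (D ! k))"
  shows "active (Node a D) (k # j # v) \<longleftrightarrow> active (children (D ! k) ! j) v"
proof (cases v)
  case Nil
  then show ?thesis by (simp add: active_def)
next
  case (Cons i w)
  then have "right_sibling (k # j # v) = k # j # right_sibling v"
    by (simp add: right_sibling_def)
  with Cons assms show ?thesis by (simp add: active_def)
qed

lemma active_Nil [simp]: "\<not> active T []"
  by (simp add: active_def)

lemma active_in_nodes: "active T u \<Longrightarrow> u \<in> nodes T"
  by (simp add: active_def)

lemma ee_Node: "ee (Node a D) = of_bool (even (length D)) + (\<Sum>u\<leftarrow>D. \<Sum>c\<leftarrow>children u. ee c)"
  unfolding ee_def by (subst card_nodes_Node) auto

lemma oe_Node:
  "oe (Node a D) = length (filter even (degs D)) + (\<Sum>u\<leftarrow>D. \<Sum>c\<leftarrow>children u. oe c)"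
  unfolding oe_def
  by (subst card_nodes_Node) (auto simp: length_filter_conv_card cong: conj_cong)

lemma odd_nodes_Node:
  "odd_nodes (Node a D) = of_bool (odd (length D)) + length (filter odd (degs D)) +
    (\<Sum>u\<leftarrow>D. \<Sum>c\<leftarrow>children u. odd_nodes c)"
  unfolding odd_nodes_def
  by (subst card_nodes_Node) (auto simp: length_filter_conv_card cong: conj_cong)

lemma act_Node: "act (Node a D) = act_pairs (degs D) + (\<Sum>u\<leftarrow>D. \<Sum>c\<leftarrow>children u. act c)"
proof -
  have "act T = card {u \<in> nodes T. active T u}" for T
    unfolding act_def by (auto intro: arg_cong[where f = card] active_in_nodes)
  then show ?thesis
    by (simp add: card_nodes_Node[where Q = active] active_Cons2 active_singleton
      card_active_head[of "degs D", symmetric] drop_degs)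
qed

lemma eact_Node: "eact (Node a D) = eact_pairs (degs D) + (\<Sum>u\<leftarrow>D. \<Sum>c\<leftarrow>children u. eact c)"
proof -
  have *: "eact T = card {u \<in> nodes T. active T u \<and> even (deg T u)}" for T
    unfolding eact_def by (auto intro: arg_cong[where f = card] active_in_nodes)
  have "{k. k < length D \<and> active (Node a D) [k] \<and> even (deg (Node a D) [k])} =
     {k. k < length (degs D) \<and> even k \<and> (active_head (drop k (degs D)) \<and> even (hd (drop k (degs D))))}"
    by (auto simp: active_singleton drop_degs hd_drop_conv_nth simp flip: drop_degs)
  then show ?thesis
    by (simp only: * card_even_active_head
      card_nodes_Node[where Q = "\<lambda>T u. active T u \<and> even (deg T u)"] active_Cons2 deg_simps)
     simp
qed

text \<open>Induction matching the two-level recursions: the hypothesis is available for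
  grandchildren of the root.\<close>

lemma ptree_induct2:
  assumes "\<And>a D. (\<And>u c. u \<in> set D \<Longrightarrow> c \<in> set (children u) \<Longrightarrow> P c) \<Longrightarrow> P (Node a D)"
  shows "P T"
proof (induction T rule: measure_induct_rule[where f = size])
  case (less T)
  obtain a D where T: "T = Node a D" by (cases T)
  show ?case unfolding T
  proof (rule assms)
    fix u c assume u: "u \<in> set D" and c: "c \<in> set (children u)"
    have "size u < size T"
      using T u by (auto simp: less_Suc_eq_le intro: size_list_estimation')
    moreover have "size c < size u"
      using c by (cases u) (auto simp: less_Suc_eq_le intro: size_list_estimation')
    ultimately show "P c" by (intro less) simp
  qed
qed

section \<open>Linear and parity relations between the statistics\<close>

lemma dvd_sum_list:
  fixes f :: "'a \<Rightarrow> 'b::comm_semiring_1"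
  shows "(\<And>x. x \<in> set xs \<Longrightarrow> d dvd f x) \<Longrightarrow> d dvd (\<Sum>x\<leftarrow>xs. f x)"
  by (induction xs) auto

lemma sum_list_cong2: "(\<Sum>u\<leftarrow>xs. \<Sum>c\<leftarrow>g u. f c) = (\<Sum>u\<leftarrow>xs. \<Sum>c\<leftarrow>g u. h c)"
  if "\<And>u c. u \<in> set xs \<Longrightarrow> c \<in> set (g u) \<Longrightarrow> f c = h c"
  using that by (intro arg_cong[where f = sum_list] map_cong refl) auto

text \<open>Each pair of children of an even-level node balances by itself: two even degrees give 0
  + 4 = 2 + 2, two odd ones 2 + 0 = 0 + 2, mixed ones 1 + 0 = 1 + 0. A last unpaired child balances
  together with its parent, whose degree is then odd.\<close>

lemma odd_nodes_oe_act: "odd_nodes T + 4 * eact T = oe T + 2 * act T"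
proof (induction T rule: ptree_induct2)
  case (1 a D)
  have "of_bool (odd (length ds)) + length (filter odd ds) + 4 * eact_pairs ds =
      length (filter even ds) + 2 * act_pairs ds" for ds
    by (induction ds rule: act_pairs.induct) auto
  from this[of "degs D"]
  have "of_bool (odd (length D)) + length (filter odd (degs D)) + 4 * eact_pairs (degs D) =
      length (filter even (degs D)) + 2 * act_pairs (degs D)" by simp
  moreover have "(\<Sum>u\<leftarrow>D. \<Sum>c\<leftarrow>children u. odd_nodes c + 4 * eact c) =
      (\<Sum>u\<leftarrow>D. \<Sum>c\<leftarrow>children u. oe c + 2 * act c)"
    by (rule sum_list_cong2) (rule 1)
  ultimately show ?case
    by (cases "even (length D)")
      (simp_all add: odd_nodes_Node oe_Node act_Node eact_Node sum_list_addf sum_list_const_mult)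
qed

text \<open>An active even node has a right sibling of even degree, and the pairs formed in this way
  are disjoint.\<close>

lemma eact_le_oe: "2 * eact T \<le> oe T"
proof (induction T rule: ptree_induct2)
  case (1 a D)
  have "2 * eact_pairs ds \<le> length (filter even ds)" for ds
    by (induction ds rule: act_pairs.induct) auto
  moreover have "(\<Sum>u\<leftarrow>D. \<Sum>c\<leftarrow>children u. 2 * eact c) \<le> (\<Sum>u\<leftarrow>D. \<Sum>c\<leftarrow>children u. oe c)"
    by (intro sum_list_mono 1)
  ultimately show ?case
    by (simp add: oe_Node eact_Node sum_list_const_mult add_mono)
qed

lemma eact_le_act: "eact T \<le> act T"
proof (induction T rule: ptree_induct2)
  case (1 a D)
  have "eact_pairs ds \<le> act_pairs ds" for ds
    by (induction ds rule: act_pairs.induct) auto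
  moreover have "(\<Sum>u\<leftarrow>D. \<Sum>c\<leftarrow>children u. eact c) \<le> (\<Sum>u\<leftarrow>D. \<Sum>c\<leftarrow>children u. act c)"
    by (intro sum_list_mono 1)
  ultimately show ?case
    by (simp add: act_Node eact_Node add_mono)
qed

lemma size_sum_list: "size (\<Sum>t\<leftarrow>ts. f t) = (\<Sum>t\<leftarrow>ts. size (f t))" for f :: "'a \<Rightarrow> 'b multiset"
  by (induction ts) auto

lemma labels_conv: "labels T = add_mset (label T) (\<Sum>t\<leftarrow>children T. labels t)"
  by (cases T) simp

lemma size_labels_Node:
  "size (labels (Node a D)) = 1 + (length D + (\<Sum>u\<leftarrow>D. \<Sum>c\<leftarrow>children u. size (labels c)))"
proof -
  have *: "size (labels u) = 1 + (\<Sum>c\<leftarrow>children u. size (labels c))" for u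
    by (subst labels_conv) (simp add: size_sum_list)
  have "(\<Sum>u\<leftarrow>D. size (labels u)) = (\<Sum>u\<leftarrow>D. 1 + (\<Sum>c\<leftarrow>children u. size (labels c)))"
    by (intro arg_cong[where f = sum_list] map_cong refl *)
  then show ?thesis by (simp only: labels.simps size_add_mset size_sum_list sum_list_addf sum_list_triv) simp
qed

lemma ee_oe_odd_nodes: "ee T + oe T + odd_nodes T = size (labels T)"
proof (induction T rule: ptree_induct2)
  case (1 a D)
  have "length (filter even ds) + length (filter odd ds) = length ds" for ds :: "nat list"
    by (rule sum_length_filter_compl)
  from this[of "degs D"] have "length (filter even (degs D)) + length (filter odd (degs D)) = length D"
    by simp
  moreover have "(\<Sum>u\<leftarrow>D. \<Sum>c\<leftarrow>children u. ee c + oe c + odd_nodes c) =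
      (\<Sum>u\<leftarrow>D. \<Sum>c\<leftarrow>children u. size (labels c))"
    by (rule sum_list_cong2) (rule 1)
  ultimately show ?case
    by (simp add: odd_nodes_Node oe_Node ee_Node sum_list_addf size_labels_Node del: labels.simps)
qed

text \<open>The degrees add up to the number of nodes minus one, and modulo 2 only the odd ones
  count.\<close>

lemma odd_nodes_parity: "even (odd_nodes T + size (labels T) + 1)"
proof (induction T rule: ptree_induct2)
  case (1 a D)
  have "even (\<Sum>u\<leftarrow>D. \<Sum>c\<leftarrow>children u. odd_nodes c + (size (labels c) + 1))"
    using 1 by (intro dvd_sum_list) (auto intro!: dvd_sum_list)
  moreover have "even (length (filter odd ds) + sum_list ds)" for ds :: "nat list"
    by (induction ds) auto
  from this[of "degs D"]
  have "even (length (filter odd (degs D)) + (\<Sum>u\<leftarrow>D. length (children u)))"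
    by (simp add: degs_def)
  ultimately show ?case
    by (simp add: odd_nodes_Node sum_list_addf size_labels_Node sum_list_triv
      del: labels.simps add_Suc_right) presburger
qed

text \<open>The three statistics add up to \<open>Suc p\<close>. For even \<open>p\<close> only
  \<open>ee T\<close> is odd, for odd \<open>p\<close> exactly the other two are, so rounding down
  always yields \<open>p div 2\<close>.\<close>

lemma halves_sum:
  assumes "size (labels T) = Suc p"
  shows "ee T div 2 + oe T div 2 + odd_nodes T div 2 = p div 2"
proof -
  have 1: "even (odd_nodes T + oe T)" 
    using arg_cong[OF odd_nodes_oe_act[of T], of even] by simp
  have 2: "even (odd_nodes T + p)"
    using odd_nodes_parity[of T] assms by simp
  have 3: "ee T + oe T + odd_nodes T = Suc p" using ee_oe_odd_nodes[of T] assms by simp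
  show ?thesis
  proof (cases "even p")
    case True
    with 1 2 arg_cong[OF 3, of even] have "even (odd_nodes T)" "even (oe T)" "odd (ee T)"
      by auto
    with 3 show ?thesis by (auto elim!: evenE oddE)
  next
    case False
    with 1 2 arg_cong[OF 3, of even] have "odd (odd_nodes T)" "odd (oe T)" "even (ee T)"
      by auto
    with 3 show ?thesis by (auto elim!: evenE oddE)
  qed
qed

lemma odd_half: "odd_nodes T div 2 + 2 * eact T = oe T div 2 + act T"
proof -
  have "(odd_nodes T + 2 * (2 * eact T)) div 2 = (oe T + 2 * act T) div 2"
    using odd_nodes_oe_act[of T] by simp
  then show ?thesis by simp
qed

section \<open>Toggling the first pair of a list of siblings\<close>

definition cnt :: "nat \<Rightarrow> ptree list \<Rightarrow> nat" where
  "cnt w A = length (filter (\<lambda>t. label t = w) A)"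

text \<open>The first tree with the label is taken because \<open>insort_key\<close> inserts in
  front of equal keys; removal and insertion thus undo each other.\<close>

definition first_with :: "nat \<Rightarrow> ptree list \<Rightarrow> ptree" where
  "first_with w A = hd (filter (\<lambda>t. label t = w) A)"

abbreviation insort_label :: "ptree \<Rightarrow> ptree list \<Rightarrow> ptree list" where
  "insort_label \<equiv> insort_key label"

abbreviation sorted_label :: "ptree list \<Rightarrow> bool" where
  "sorted_label A \<equiv> sorted (map label A)"

text \<open>Here \<open>A\<close> and \<open>B\<close> are the children of \<open>u\<close> and of its right sibling \<open>y\<close>, and \<open>m = label y\<close>.
  A child carrying the largest movable label is transferred; the choice of direction by the parity
  of its multiplicity in \<open>A\<close> leaves the largest movable label unchanged, so that the same rule
  undoes the transfer.\<close>

definition movable :: "nat \<Rightarrow> ptree list \<Rightarrow> ptree list \<Rightarrow> nat set" where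
  "movable m A B = label ` set B \<union> {w. m \<le> w \<and> odd (cnt w A)}"

text \<open>If \<open>movable m A B\<close> is empty, then \<open>B = []\<close>, so the right
  sibling has no children of its own to lose when it adopts \<open>D\<close>. This case and the
  second equation reverse each other.\<close>

fun toggle_head :: "ptree list \<Rightarrow> ptree list" where
  "toggle_head [] = []"
| "toggle_head [Node l A] =
    (let c = first_with (Max {w. odd (cnt w A)}) A
     in Node l (remove1 c A) # Node (label c) [] # children c)"
| "toggle_head (Node l A # Node m B # D) =
    (if movable m A B = {} then [Node l (insort_label (Node m D) A)]
     else let w = Max (movable m A B) in
       if odd (cnt w A)
       then let c = first_with w A in Node l (remove1 c A) # Node m (insort_label c B) # D
       else let c = first_with w B in Node l (insort_label c A) # Node m (remove1 c B) # D)"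

text \<open>Both kinds of transfer, each in one orientation and with both sides explicit, so that
  every invariant is checked once for the two directions. The premises ensure that
  \<open>toggle_head\<close> sends either side to the other.\<close>

inductive toggle_rel :: "ptree list \<Rightarrow> ptree list \<Rightarrow> bool" where
  merge: "toggle_rel [Node l (insort_label c A)] (Node l A # Node (label c) [] # children c)"
    if "sorted_label A" "even (length A)" "\<And>w. label c \<le> w \<Longrightarrow> even (cnt w A)"
| move: "toggle_rel (Node l A # Node m (insort_label c B) # D) (Node l (insort_label c A) # Node m B # D)"
    if "sorted_label A" "sorted_label B" "even (length A) \<noteq> even (length B)" "m \<le> label c"
      "\<And>w. label c \<le> w \<Longrightarrow> even (cnt w A)" "\<And>t. t \<in> set B \<Longrightarrow> label t \<le> label c"

lemma cnt_pos: "cnt w A \<noteq> 0 \<longleftrightarrow> w \<in> label ` set A"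
  by (auto simp: cnt_def filter_empty_conv)

lemma cnt_insort: "sorted_label A \<Longrightarrow> cnt w (insort_label c A) = of_bool (label c = w) + cnt w A"
  by (cases "label c = w") (simp_all add: cnt_def filter_insort filter_insort_triv)

lemma cnt_remove1: "c \<in> set A \<Longrightarrow> cnt w A = of_bool (label c = w) + cnt w (remove1 c A)"
  unfolding cnt_def by (induction A) auto

lemma filter_insort_same:
  "sorted_label A \<Longrightarrow> filter (\<lambda>t. label t = label c) (insort_label c A) =
    c # filter (\<lambda>t. label t = label c) A"
  by (subst filter_insort) (auto intro!: insort_is_Cons)

lemma first_with_insort: "sorted_label A \<Longrightarrow> first_with (label c) (insort_label c A) = c"
  by (simp add: first_with_def filter_insort_same)

lemma first_with_props:
  assumes "w \<in> label ` set A"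
  shows "first_with w A \<in> set A" "label (first_with w A) = w"
proof -
  have "filter (\<lambda>t. label t = w) A \<noteq> []" using assms by (auto simp: filter_empty_conv)
  from hd_in_set[OF this]
  show "first_with w A \<in> set A" "label (first_with w A) = w" by (auto simp: first_with_def)
qed

lemma insort_first_with:
  assumes "w \<in> label ` set A" "sorted_label A"
  shows "insort_label (first_with w A) (remove1 (first_with w A) A) = A"
proof (rule insort_key_remove1)
  show "hd (filter (\<lambda>t. label (first_with w A) = label t) A) = first_with w A"
    by (subst first_with_props(2)[OF assms(1)]) (simp add: first_with_def eq_commute)
qed (use assms first_with_props in auto)

lemma sum_list_insort:
  "(\<Sum>t\<leftarrow>insort_label c A. f t) = f c + (\<Sum>t\<leftarrow>A. f t)" for f :: "ptree \<Rightarrow> 'b::comm_monoid_add"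
  by (induction A) (auto simp: add.left_commute)

lemma odd_cnt_finite: "finite {w. odd (cnt w A)}"
proof (rule finite_subset)
  show "{w. odd (cnt w A)} \<subseteq> label ` set A" using cnt_pos by fastforce
qed simp

lemma movable_finite: "finite (movable m A B)"
  using finite_subset[OF _ odd_cnt_finite[of A], of "{w. m \<le> w \<and> odd (cnt w A)}"]
  by (auto simp: movable_def)

text \<open>In \<open>move\<close>, \<open>label c\<close> is the maximum of \<open>movable\<close>
  on both sides, and the parity of its multiplicity under the first node tells on which side
  \<open>c\<close> is. In \<open>merge\<close>, it is the largest label of odd multiplicity on the
  left, while \<open>movable\<close> is empty on the right.\<close>

lemma toggle_rel_toggle_head:
  assumes "toggle_rel S S'"
  shows "toggle_head S = S'" "toggle_head S' = S"
proof -
  have "toggle_head S = S' \<and> toggle_head S' = S"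
    using assms
  proof cases
    case (merge A c l)
    have "Max {w. odd (cnt w (insort_label c A))} = label c"
    proof (rule Max_eqI)
      fix w assume "w \<in> {w. odd (cnt w (insort_label c A))}"
      then show "w \<le> label c" using merge(3,5)
        by (cases "w \<le> label c") (auto simp: cnt_insort)
    qed (use merge in \<open>auto simp: odd_cnt_finite\<close>, simp add: cnt_insort)
    moreover have "movable (label c) A [] = {}" using merge by (auto simp: movable_def)
    ultimately show ?thesis using merge
      by (simp add: first_with_insort remove1_insort_key)
  next
    case (move A B m c l D)
    have 1: "Max (movable m A (insort_label c B)) = label c"
    proof (rule Max_eqI)
      fix w assume "w \<in> movable m A (insort_label c B)"
      then show "w \<le> label c" using move
        by (cases "w \<le> label c") (auto simp: movable_def set_insort_key)
    qed (rule movable_finite, simp add: movable_def set_insort_key)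
    have 2: "Max (movable m (insort_label c A) B) = label c"
    proof (rule Max_eqI)
      fix w assume "w \<in> movable m (insort_label c A) B"
      then show "w \<le> label c" using move
        by (cases "w \<le> label c") (auto simp: movable_def cnt_insort)
    qed (rule movable_finite, use move in \<open>simp add: movable_def cnt_insort\<close>)
    have 3: "movable m A (insort_label c B) \<noteq> {}" "movable m (insort_label c A) B \<noteq> {}"
      using move by (auto simp: movable_def set_insort_key cnt_insort)
    have 4: "even (cnt (label c) A)" "odd (cnt (label c) (insort_label c A))"
      using move by (auto simp: cnt_insort)
    show ?thesis using move
      by (simp add: 1 2 3 4 first_with_insort remove1_insort_key)
  qed
  then show "toggle_head S = S'" "toggle_head S' = S" by auto
qed

text \<open>Guarantees a label to select for an odd node without right sibling: the multiplicities
  add up to the length, so they cannot all be even.\<close>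

lemma odd_length_odd_cnt:
  assumes "odd (length A)"
  shows "\<exists>w. odd (cnt w A)"
proof (rule ccontr)
  assume "\<not> ?thesis"
  moreover have "length A = (\<Sum>w\<in>label ` set A. cnt w A)"
    using sum_count_set[of "map label A" "label ` set A"]
    by (simp add: cnt_def count_list_eq_length_filter filter_map comp_def eq_commute)
  ultimately show False using assms by (metis dvd_sum)
qed

text \<open>Every active configuration is one side of a rule: taking out the selected child leaves
  only even multiplicities from its label upwards, which is the premise of the rules.\<close>

lemma toggle_head_toggle_rel:
  assumes act: "active_head (degs S)"
    and sor: "\<And>u. u \<in> set S \<Longrightarrow> sorted_label (children u)"
    and inc: "\<And>u c. u \<in> set S \<Longrightarrow> c \<in> set (children u) \<Longrightarrow> label u \<le> label c"
  shows "toggle_rel S (toggle_head S) \<or> toggle_rel (toggle_head S) S"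
proof -
  consider l A where "S = [Node l A]" | l A m B D where "S = Node l A # Node m B # D"
    using act by (metis active_head.simps(1) degs_simps(1) list.exhaust ptree.exhaust)
  then show ?thesis
  proof cases
    case (1 l A)
    define w where "w = Max {w. odd (cnt w A)}"
    define c where "c = first_with w A"
    have oA: "odd (length A)" and sA: "sorted_label A" using 1 act sor by auto
    have w: "odd (cnt w A)" and wmax: "w < w' \<Longrightarrow> even (cnt w' A)" for w'
      using Max_in[OF odd_cnt_finite[of A]] odd_length_odd_cnt[OF oA] Max_ge[OF odd_cnt_finite[of A]]
      by (auto simp: w_def not_less[symmetric])
    then have wA: "w \<in> label ` set A" using cnt_pos by fastforce
    note c = first_with_props[OF wA, folded c_def] and ins = insort_first_with[OF wA sA, folded c_def]
    have "toggle_rel [Node l (insort_label c (remove1 c A))]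
        (Node l (remove1 c A) # Node (label c) [] # children c)"
    proof (rule toggle_rel.merge)
      show "even (length (remove1 c A))" using oA c by (simp add: length_remove1)
      fix w' assume "label c \<le> w'"
      then show "even (cnt w' (remove1 c A))"
        using w wmax[of w'] cnt_remove1[OF c(1), of w'] c(2) by (cases "w' = w") auto
    qed (simp add: sorted_map_remove1 sA)
    then show ?thesis using 1 ins by (simp add: w_def[symmetric] c_def[symmetric] Let_def)
  next
    case (2 l A m B D)
    have sA: "sorted_label A" and sB: "sorted_label B" and mB: "\<And>b. b \<in> set B \<Longrightarrow> m \<le> label b"
      and par: "even (length A) = even (length B)"
      using 2 act sor[of "Node l A"] sor[of "Node m B"] inc[of "Node m B"] by auto
    show ?thesis
    proof (cases "movable m A B = {}")
      case True
      then have B: "B = []" and ev: "\<And>w. m \<le> w \<Longrightarrow> even (cnt w A)" by (auto simp: movable_def)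
      have "toggle_rel [Node l (insort_label (Node m D) A)]
          (Node l A # Node (label (Node m D)) [] # children (Node m D))"
        by (rule toggle_rel.merge) (use sA par B ev in auto)
      then show ?thesis using 2 True B by simp
    next
      case False
      define w where "w = Max (movable m A B)"
      have w: "w \<in> movable m A B" using Max_in[OF movable_finite False] by (simp add: w_def)
      have wmax: "w' \<le> w" if "w' \<in> movable m A B" for w'
        using Max_ge[OF movable_finite that] by (simp add: w_def)
      have mw: "m \<le> w" using w mB by (auto simp: movable_def)
      \<comment> \<open>By \<open>mw\<close>, labels above \<open>w\<close> pass the bound
        \<open>m\<close> in \<open>movable\<close>; an odd multiplicity would make them movable and
        contradict maximality.\<close>
      have ev: "even (cnt w' A)" if "w < w'" for w'
        using wmax[of w'] mw that by (auto simp: movable_def)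
      have Bw: "label b \<le> w" if "b \<in> set B" for b
        using wmax[of "label b"] that by (auto simp: movable_def)
      show ?thesis
      proof (cases "odd (cnt w A)")
        case odd: True
        define c where "c = first_with w A"
        have wA: "w \<in> label ` set A" using odd cnt_pos by fastforce
        note c = first_with_props[OF wA, folded c_def]
          and ins = insort_first_with[OF wA sA, folded c_def]
        have "toggle_rel (Node l (remove1 c A) # Node m (insort_label c B) # D)
            (Node l (insort_label c (remove1 c A)) # Node m B # D)"
        proof (rule toggle_rel.move)
          show "even (length (remove1 c A)) \<noteq> even (length B)"
            using par c length_pos_if_in_set[OF c(1)] by (simp add: length_remove1)
          fix w' assume "label c \<le> w'"
          then show "even (cnt w' (remove1 c A))"
            using odd ev[of w'] cnt_remove1[OF c(1), of w'] c(2) by (cases "w' = w") auto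
        qed (use sA sB mw c Bw in \<open>auto simp: sorted_map_remove1\<close>)
        then show ?thesis
          using 2 False odd ins by (simp add: w_def[symmetric] c_def[symmetric] Let_def)
      next
        case even: False
        define c where "c = first_with w B"
        have wB: "w \<in> label ` set B" using w even by (auto simp: movable_def)
        note c = first_with_props[OF wB, folded c_def]
          and ins = insort_first_with[OF wB sB, folded c_def]
        have "toggle_rel (Node l A # Node m (insort_label c (remove1 c B)) # D)
            (Node l (insort_label c A) # Node m (remove1 c B) # D)"
        proof (rule toggle_rel.move)
          show "even (length A) \<noteq> even (length (remove1 c B))"
            using par c length_pos_if_in_set[OF c(1)] by (simp add: length_remove1)
          fix w' assume "label c \<le> w'"
          then show "even (cnt w' A)"
            using even ev[of w'] c(2) by (cases "w' = w") auto
        next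
          fix b assume "b \<in> set (remove1 c B)"
          then show "label b \<le> label c" using Bw c set_remove1_subset by fastforce
        qed (use sA sB mw c in \<open>auto simp: sorted_map_remove1\<close>)
        then show ?thesis
          using 2 False even ins by (simp add: w_def[symmetric] c_def[symmetric] Let_def)
      qed
    qed
  qed
qed

section \<open>Invariants of the toggle\<close>

lemma act_pairs_append: "even (length ds) \<Longrightarrow> act_pairs (ds @ es) = act_pairs ds + act_pairs es"
  by (induction ds rule: act_pairs.induct) auto

lemma eact_pairs_append:
  "even (length ds) \<Longrightarrow> eact_pairs (ds @ es) = eact_pairs ds + eact_pairs es"
  by (induction ds rule: eact_pairs.induct) auto

lemma weakly_increasing_conv: "weakly_increasing T \<longleftrightarrow> sorted_label (children T) \<and>
    (\<forall>t\<in>set (children T). label T \<le> label t \<and> weakly_increasing t)"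
  by (cases T) simp

text \<open>In \<open>merge\<close>, \<open>label c\<close> bounds the labels of
  \<open>children c\<close> from below in either reading, as parent or as left sibling. In
  \<open>move\<close>, \<open>l \<le> m \<le> label c\<close> lets \<open>c\<close> hang below
  either node.\<close>

lemma toggle_rel_weakly_increasing:
  assumes "toggle_rel S S'"
  shows "weakly_increasing (Node a (P @ S)) \<longleftrightarrow> weakly_increasing (Node a (P @ S'))"
  using assms
proof cases
  case (merge A c l)
  then show ?thesis
    by (auto simp: sorted_append sorted_insort_key set_insort_key weakly_increasing_conv[of c])
      (meson order_trans)+
next
  case (move A B m c l D)
  then show ?thesis
    by (auto simp: sorted_append sorted_insort_key set_insort_key)
qed

lemma toggle_rel_labels:
  assumes "toggle_rel S S'"
  shows "labels (Node a (P @ S)) = labels (Node a (P @ S'))"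
  using assms
proof cases
  case (merge A c l)
  then show ?thesis by (cases c) (auto simp: sum_list_insort ac_simps)
next
  case (move A B m c l D)
  then show ?thesis by (auto simp: sum_list_insort ac_simps)
qed

text \<open>In \<open>merge\<close>, \<open>c\<close> leaves level 2 and the degree of the root, odd
  before, takes over the parity of the degree of \<open>c\<close>. The children of \<open>c\<close>
  rise by two levels, which preserves level parity.\<close>

lemma toggle_rel_ee:
  assumes "toggle_rel S S'" "even (length P)"
  shows "ee (Node a (P @ S)) = ee (Node a (P @ S'))"
  using assms(1)
proof cases
  case (merge A c l)
  then show ?thesis using assms(2) by (cases c) (auto simp: ee_Node sum_list_insort)
next
  case (move A B m c l D)
  then show ?thesis by (auto simp: ee_Node sum_list_insort)
qed

text \<open>In \<open>merge\<close>, the children of \<open>c\<close> come to stand behind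
  \<open>P\<close> and two more siblings, an even number in all, so they are paired as they were
  under \<open>c\<close>.\<close>

lemma toggle_rel_act:
  assumes "toggle_rel S S'" "even (length P)"
  shows "act (Node a (P @ S)) = act (Node a (P @ S'))"
  using assms(1)
proof cases
  case (merge A c l)
  then show ?thesis using assms(2)
    by (cases c) (auto simp: act_Node sum_list_insort act_pairs_append)
next
  case (move A B m c l D)
  then show ?thesis using assms(2) by (auto simp: act_Node sum_list_insort act_pairs_append)
qed

lemma toggle_rel_eact:
  assumes "toggle_rel S S'" "even (length P)"
  shows "eact (Node a (P @ S)) + of_bool (even (hd (degs S'))) =
    eact (Node a (P @ S')) + of_bool (even (hd (degs S)))"
  using assms(1)
proof cases
  case (merge A c l)
  then show ?thesis using assms(2)
    by (cases c) (auto simp: eact_Node sum_list_insort eact_pairs_append)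
next
  case (move A B m c l D)
  then show ?thesis using assms(2) by (auto simp: eact_Node sum_list_insort eact_pairs_append)
qed

lemma toggle_rel_head:
  assumes "toggle_rel S S'"
  shows "S \<noteq> []" "S' \<noteq> []" "active_head (degs S)" "active_head (degs S')"
    "even (hd (degs S)) \<longleftrightarrow> odd (hd (degs S'))"
  using assms by (cases; auto)+

section \<open>Toggling an arbitrary active node\<close>

text \<open>A toggle acts on the suffix of siblings that starts at the marked node, which therefore
  keeps its address. The first equation is a default: the empty address is never active.\<close>

fun toggle_at :: "ptree \<Rightarrow> nat list \<Rightarrow> ptree" where
  "toggle_at T [] = T"
| "toggle_at (Node a D) [k] = Node a (take k D @ toggle_head (drop k D))"
| "toggle_at (Node a D) (k # j # v) = Node a (D[k := Node (label (D ! k))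
     ((children (D ! k))[j := toggle_at (children (D ! k) ! j) v])])"

text \<open>The equation for \<open>eact\<close> is additive to avoid truncated subtraction. Keeping
  the root label is what preserves the order conditions when the tree is replaced inside a larger
  one.\<close>

definition toggles_to :: "ptree \<Rightarrow> nat list \<Rightarrow> ptree \<Rightarrow> bool" where
  "toggles_to T u T' \<longleftrightarrow> weakly_increasing T' \<and> label T' = label T \<and> labels T' = labels T \<and>
     ee T' = ee T \<and> act T' = act T \<and>
     eact T' + of_bool (even (deg T u)) = eact T + of_bool (odd (deg T u)) \<and>
     active T' u \<and> (even (deg T' u) \<longleftrightarrow> odd (deg T u)) \<and> toggle_at T' u = T"

text \<open>Induction along the address. At its end the suffix lemmas apply; above, one grandchild
  is replaced by a tree with equal root label, labels, \<open>ee\<close> and \<open>act\<close>,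
  while the degrees of the root and its children stay as they are.\<close>

lemma toggles_to_toggle:
  assumes "weakly_increasing T" "active T u"
  shows "toggles_to T u (toggle_at T u)"
  using assms
proof (induction T u rule: toggle_at.induct)
  case (1 T)
  then show ?case by simp
next
  case (2 a D k)
  define P S S' where "P = take k D" and "S = drop k D" and "S' = toggle_head (drop k D)"
  have k: "k < length D" "even k" and act: "active_head (degs S)"
    using 2 by (auto simp: active_singleton S_def)
  have D: "D = P @ S" and P: "length P = k" "even (length P)"
    using k by (simp_all add: P_def S_def)
  have rel: "toggle_rel S S' \<or> toggle_rel S' S"
    unfolding S_def S'_def
  proof (rule toggle_head_toggle_rel)
    fix u assume "u \<in> set (drop k D)"
    then have "weakly_increasing u" using 2(1) by (auto dest: in_set_dropD)
    then show "sorted_label (children u)" "c \<in> set (children u) \<Longrightarrow> label u \<le> label c" for c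
      by (simp_all add: weakly_increasing_conv[of u])
  qed (use act in \<open>simp add: S_def\<close>)
  have nth: "length (children ((P @ R) ! k)) = hd (degs R)" if "R \<noteq> []" for R
    using that P by (cases R) (auto simp: nth_append)
  have tog: "toggle_at (Node a D) [k] = Node a (P @ S')"
    by (simp add: P_def S'_def)
  have "toggles_to (Node a (P @ S)) [k] (Node a (P @ S'))"
  proof -
    have ne: "S \<noteq> []" "S' \<noteq> []" and hd: "active_head (degs S')"
      "even (hd (degs S')) \<longleftrightarrow> odd (hd (degs S))" and revert: "toggle_head S' = S"
      using rel toggle_rel_head[of S S'] toggle_rel_head[of S' S]
        toggle_rel_toggle_head[of S S'] toggle_rel_toggle_head[of S' S] by auto
    have wi: "weakly_increasing (Node a (P @ S'))"
      using rel 2(1) toggle_rel_weakly_increasing[of S S' a P] toggle_rel_weakly_increasing[of S' S a P]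
      unfolding D by auto
    have lab: "labels (Node a (P @ S')) = labels (Node a (P @ S))"
      using rel toggle_rel_labels by metis
    have stat: "ee (Node a (P @ S')) = ee (Node a (P @ S))" "act (Node a (P @ S')) = act (Node a (P @ S))"
      using rel toggle_rel_ee toggle_rel_act P(2) by metis+
    have "eact (Node a (P @ S')) + of_bool (even (hd (degs S))) =
        eact (Node a (P @ S)) + of_bool (even (hd (degs S')))"
      using rel toggle_rel_eact[OF _ P(2), of S S' a] toggle_rel_eact[OF _ P(2), of S' S a] by auto
    then show ?thesis
      using wi lab stat ne hd revert k P
      by (simp add: toggles_to_def nth active_singleton del: labels.simps weakly_increasing.simps)
  qed
  then show ?case using tog D by simp
next
  case (3 a D k j v)
  have kj: "k < length D" "j < length (children (D ! k))"
    using 3(3) active_in_nodes by fastforce+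
  obtain P u Q where D: "D = P @ u # Q" and P: "length P = k"
    using kj(1) by (metis id_take_nth_drop length_take min.absorb4)
  obtain l A c B where u: "u = Node l (A @ c # B)" and A: "length A = j"
    using kj(2) by (metis D P id_take_nth_drop length_take min.absorb4 nth_append_length ptree.exhaust_sel)
  have Dk: "D ! k = Node l (A @ c # B)" and cj: "children (D ! k) ! j = c"
    using D P u A by (auto simp: nth_append)
  have wc: "weakly_increasing c" using 3(2) D u by auto
  have ac: "active c v" using 3(3) active_Cons2[OF kj] cj by simp
  define c' where "c' = toggle_at c v"
  have fl: "toggles_to c v c'" using 3(1) wc ac cj by (simp add: c'_def)
  have tog: "toggle_at (Node a D) (k # j # v) = Node a (P @ Node l (A @ c' # B) # Q)"
    using D P u A by (auto simp: nth_append list_update_append c'_def)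
  have revert: "toggle_at (Node a (P @ Node l (A @ c' # B) # Q)) (k # j # v) = Node a D"
    using D P u A fl by (auto simp: nth_append list_update_append toggles_to_def)
  have "active (Node a (P @ Node l (A @ c' # B) # Q)) (k # j # v)"
    using P A fl by (subst active_Cons2) (auto simp: nth_append toggles_to_def)
  moreover have "weakly_increasing (Node a (P @ Node l (A @ c' # B) # Q))"
    using 3(2) fl by (auto simp: D u toggles_to_def)
  ultimately show ?case
    unfolding tog using fl revert D u P A
    by (auto simp: toggles_to_def ee_Node act_Node eact_Node nth_append)
qed

section \<open>Counting trees by their active even nodes\<close>

definition trees_with :: "nat multiset \<Rightarrow> nat \<Rightarrow> nat \<Rightarrow> nat \<Rightarrow> ptree set" where
  "trees_with M i a e = {T \<in> wi_trees M. ee T div 2 = i \<and> act T = a \<and> eact T = e}"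

lemma finite_trees_with: "finite (trees_with M i a e)"
  by (simp add: trees_with_def finite_wi_trees)

lemma finite_active: "finite {u. active T u \<and> R u}"
  by (rule finite_subset[OF _ finite_nodes[of T]]) (auto simp: active_in_nodes)

lemma card_active_odd: "card {u. active T u \<and> odd (deg T u)} = act T - eact T"
proof -
  have "{u. active T u \<and> odd (deg T u)} = {u. active T u} - {u. active T u \<and> even (deg T u)}"
    by auto
  moreover have "card \<dots> = card {u. active T u} - card {u. active T u \<and> even (deg T u)}"
    by (rule card_Diff_subset) (auto simp: finite_active)
  ultimately show ?thesis by (simp add: act_def eact_def)
qed

lemma toggle_trees_with:
  assumes "T \<in> trees_with M i a e" "active T u"
  shows "toggle_at T u \<in> trees_with M i a (if even (deg T u) then e - 1 else Suc e)"
    "active (toggle_at T u) u" "even (deg (toggle_at T u) u) \<longleftrightarrow> odd (deg T u)" "toggle_at (toggle_at T u) u = T"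
proof -
  have "toggles_to T u (toggle_at T u)"
    using assms by (intro toggles_to_toggle) (auto simp: trees_with_def wi_trees_def)
  then show "toggle_at T u \<in> trees_with M i a (if even (deg T u) then e - 1 else Suc e)"
    "active (toggle_at T u) u" "even (deg (toggle_at T u) u) \<longleftrightarrow> odd (deg T u)" "toggle_at (toggle_at T u) u = T"
    using assms by (auto simp: toggles_to_def trees_with_def wi_trees_def)
qed

text \<open>Both sides count trees with a marked active node, even on the left and odd on the right.\<close>

lemma card_trees_with_Suc:
  "Suc e * card (trees_with M i a (Suc e)) = (a - e) * card (trees_with M i a e)"
proof -
  let ?E = "SIGMA T:trees_with M i a (Suc e). {u. active T u \<and> even (deg T u)}"
  let ?O = "SIGMA T:trees_with M i a e. {u. active T u \<and> odd (deg T u)}"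
  \<comment> \<open>The mark stays put and toggling twice at it is the identity, so one formula
    serves both directions.\<close>
  have "bij_betw (\<lambda>(T, u). (toggle_at T u, u)) ?E ?O"
  proof (rule bij_betw_byWitness[where f' = "\<lambda>(T, u). (toggle_at T u, u)"])
    show "(\<lambda>(T, u). (toggle_at T u, u)) ` ?E \<subseteq> ?O"
    proof clarify
      fix T u assume "T \<in> trees_with M i a (Suc e)" "active T u" "even (deg T u)"
      with toggle_trees_with[OF this(1,2)] show "toggle_at T u \<in> trees_with M i a e \<and>
        u \<in> {u'. active (toggle_at T u) u' \<and> odd (deg (toggle_at T u) u')}" by simp
    qed
    show "(\<lambda>(T, u). (toggle_at T u, u)) ` ?O \<subseteq> ?E"
    proof clarify
      fix T u assume "T \<in> trees_with M i a e" "active T u" "odd (deg T u)"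
      with toggle_trees_with[OF this(1,2)] show "toggle_at T u \<in> trees_with M i a (Suc e) \<and>
        u \<in> {u'. active (toggle_at T u) u' \<and> even (deg (toggle_at T u) u')}" by simp
    qed
  qed (auto simp: toggle_trees_with(4))
  then have "card ?E = card ?O" by (rule bij_betw_same_card)
  moreover have "card ?E = (\<Sum>T\<in>trees_with M i a (Suc e). eact T)"
    by (subst card_SigmaI) (auto simp: finite_trees_with finite_active eact_def)
  moreover have "card ?O = (\<Sum>T\<in>trees_with M i a e. act T - eact T)"
    by (subst card_SigmaI) (auto simp: finite_trees_with finite_active card_active_odd)
  moreover have "(\<Sum>T\<in>trees_with M i a (Suc e). eact T) = (\<Sum>T\<in>trees_with M i a (Suc e). Suc e)"
    by (rule sum.cong) (auto simp: trees_with_def)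
  moreover have "(\<Sum>T\<in>trees_with M i a e. act T - eact T) = (\<Sum>T\<in>trees_with M i a e. a - e)"
    by (rule sum.cong) (auto simp: trees_with_def)
  ultimately show ?thesis by (simp add: mult.commute)
qed

text \<open>The binomial coefficients obey the same recurrence in \<open>e\<close>; for
  \<open>e \<ge> a\<close> the truncated factor \<open>a - e\<close> is zero.\<close>

lemma card_trees_with:
  "card (trees_with M i a e) = (a choose e) * card (trees_with M i a 0)"
proof (induction e)
  case (Suc e)
  have "Suc e * card (trees_with M i a (Suc e)) = ((a - e) * (a choose e)) * card (trees_with M i a 0)"
    using card_trees_with_Suc[of e M i a] Suc by simp
  also have "(a - e) * (a choose e) = Suc e * (a choose Suc e)"
    by (metis binomial_absorb_comp binomial_absorption mult.commute)
  finally show ?case by (simp only: mult.assoc mult_cancel1) simp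
qed simp

section \<open>The expansion\<close>

lemma size_labels_wi_trees: "T \<in> wi_trees M \<Longrightarrow> size (labels T) = Suc (size M)"
  by (simp add: wi_trees_def)

text \<open>The index \<open>j\<close> of the expansion, that is, the exponent of \<open>yz\<close>
  contributed by the tree. By \<open>eact_le_oe\<close> the subtraction does not truncate.\<close>

definition excess :: "ptree \<Rightarrow> nat" where
  "excess T = oe T div 2 - eact T"

lemma wi_trees_halves:
  assumes "T \<in> wi_trees M"
  shows "oe T div 2 = excess T + eact T" "odd_nodes T div 2 = excess T + (act T - eact T)"
    "ee T div 2 + 2 * excess T + act T = size M div 2" "eact T \<le> act T"
proof -
  have le: "eact T \<le> oe T div 2" using eact_le_oe[of T] by simp
  note facts = le halves_sum[OF size_labels_wi_trees[OF assms]] odd_half[of T] eact_le_act[of T]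
  show "oe T div 2 = excess T + eact T" "odd_nodes T div 2 = excess T + (act T - eact T)"
    "ee T div 2 + 2 * excess T + act T = size M div 2" "eact T \<le> act T"
    using facts unfolding excess_def by linarith+
qed

lemma gamma_hat_trees_with:
  "i + 2 * j \<le> size M div 2 \<Longrightarrow>
    gamma_hat M i j = card (trees_with M i (size M div 2 - i - 2 * j) 0)"
  unfolding gamma_hat_def trees_with_def by (rule arg_cong[where f = card]) auto

lemma finite_gamma_indices: "finite {j. i + 2 * j \<le> (q :: nat)}"
  by (rule finite_subset[of _ "{..q}"]) auto

text \<open>Trees are grouped by \<open>excess T = j\<close> and \<open>eact T = e\<close>. This
  forces \<open>act T = a\<close> with \<open>a = q - i - 2 * j\<close>, the monomial is constantly
  \<open>y ^ (j + e) * z ^ (j + (a - e))\<close> on a group, and by \<open>card_trees_with\<close>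
  the sum over \<open>e\<close> is a binomial expansion.\<close>

lemma sum_fixed_ee:
  fixes y z :: "'a::comm_semiring_1" and M :: "nat multiset"
  defines "q \<equiv> size M div 2"
  shows "(\<Sum>T | T \<in> wi_trees M \<and> ee T div 2 = i. y ^ (oe T div 2) * z ^ (odd_nodes T div 2)) =
    (\<Sum>j | i + 2 * j \<le> q. of_nat (gamma_hat M i j) * (y * z) ^ j * (y + z) ^ (q - i - 2 * j))"
proof -
  let ?S = "{T \<in> wi_trees M. ee T div 2 = i}" and ?J = "{j. i + 2 * j \<le> q}"
  let ?f = "\<lambda>T. y ^ (oe T div 2) * z ^ (odd_nodes T div 2)"
  let ?K = "SIGMA j:?J. {..q - i - 2 * j}"
  let ?g = "\<lambda>T. (excess T, eact T)"
  have finJ: "finite ?J" by (rule finite_gamma_indices)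
  have finS: "finite ?S" by (simp add: finite_wi_trees)
  have "sum ?f ?S = (\<Sum>k\<in>?K. \<Sum>T\<in>{T \<in> ?S. ?g T = k}. ?f T)"
  proof (rule sum.group[symmetric])
    show "?g ` ?S \<subseteq> ?K"
      using wi_trees_halves[of _ M] by (force simp: q_def)
  qed (use finJ finS in auto)
  also have "\<dots> = (\<Sum>(j, e)\<in>?K. of_nat (gamma_hat M i j) * (y * z) ^ j *
      (of_nat (q - i - 2 * j choose e) * y ^ e * z ^ (q - i - 2 * j - e)))"
  proof (rule sum.cong[OF refl])
    fix k assume "k \<in> ?K"
    then obtain j e where k: "k = (j, e)" and je: "i + 2 * j \<le> q" "e \<le> q - i - 2 * j" by auto
    let ?a = "q - i - 2 * j"
    have eq: "{T \<in> ?S. ?g T = (j, e)} = trees_with M i ?a e"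
    proof (intro equalityI subsetI)
      fix T assume "T \<in> {T \<in> ?S. ?g T = (j, e)}"
      then show "T \<in> trees_with M i ?a e"
        using wi_trees_halves[of T M] by (auto simp: trees_with_def q_def)
    next
      fix T assume T: "T \<in> trees_with M i ?a e"
      then have "excess T = j"
        using wi_trees_halves(3)[of T M] je by (simp add: trees_with_def q_def)
      with T show "T \<in> {T \<in> ?S. ?g T = (j, e)}" by (simp add: trees_with_def)
    qed
    have "(\<Sum>T\<in>{T \<in> ?S. ?g T = (j, e)}. ?f T) =
        (\<Sum>T\<in>{T \<in> ?S. ?g T = (j, e)}. y ^ (j + e) * z ^ (j + (?a - e)))"
    proof (rule sum.cong[OF refl])
      fix T assume T: "T \<in> {T \<in> ?S. ?g T = (j, e)}"
      then have "act T = ?a" using eq by (auto simp: trees_with_def)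
      with T show "?f T = y ^ (j + e) * z ^ (j + (?a - e))"
        using wi_trees_halves[of T M] by simp
    qed
    also have "\<dots> = of_nat (card (trees_with M i ?a e)) * (y ^ (j + e) * z ^ (j + (?a - e)))"
      by (simp only: eq sum_constant)
    also have "\<dots> = of_nat (gamma_hat M i j) * (y * z) ^ j *
        (of_nat (?a choose e) * y ^ e * z ^ (?a - e))"
      using je(1) unfolding q_def
      by (subst card_trees_with)
        (simp only: gamma_hat_trees_with power_add power_mult_distrib of_nat_mult ac_simps)
    finally show "(\<Sum>T\<in>{T \<in> ?S. ?g T = k}. ?f T) = (case k of (j, e) \<Rightarrow>
        of_nat (gamma_hat M i j) * (y * z) ^ j *
        (of_nat (q - i - 2 * j choose e) * y ^ e * z ^ (q - i - 2 * j - e)))"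
      by (simp only: k prod.case)
  qed
  also have "\<dots> = (\<Sum>j\<in>?J. \<Sum>e\<le>q - i - 2 * j. of_nat (gamma_hat M i j) * (y * z) ^ j *
      (of_nat (q - i - 2 * j choose e) * y ^ e * z ^ (q - i - 2 * j - e)))"
    by (rule sum.Sigma[symmetric]) (use finJ in auto)
  also have "\<dots> = (\<Sum>j\<in>?J. of_nat (gamma_hat M i j) * (y * z) ^ j * (y + z) ^ (q - i - 2 * j))"
    by (simp add: binomial_ring sum_distrib_left)
  finally show ?thesis by simp
qed

lemma S_hat_expansion:
  fixes x y z :: "'a::comm_semiring_1" and M :: "nat multiset"
  defines "q \<equiv> size M div 2"
  shows "S_hat M x y z = (\<Sum>i\<le>q. x ^ i * (\<Sum>j | i + 2 * j \<le> q.
    of_nat (gamma_hat M i j) * (y * z) ^ j * (y + z) ^ (q - i - 2 * j)))"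
proof -
  let ?f = "\<lambda>T. y ^ (oe T div 2) * z ^ (odd_nodes T div 2)"
  have "S_hat M x y z = (\<Sum>i\<le>q. \<Sum>T | T \<in> wi_trees M \<and> ee T div 2 = i. x ^ (ee T div 2) * ?f T)"
    unfolding S_hat_def mult.assoc
  proof (rule sum.group[symmetric])
    show "(\<lambda>T. ee T div 2) ` wi_trees M \<subseteq> {..q}"
      using wi_trees_halves(3)[of _ M] by (force simp: q_def)
  qed (auto simp: finite_wi_trees)
  also have "\<dots> = (\<Sum>i\<le>q. x ^ i * (\<Sum>T | T \<in> wi_trees M \<and> ee T div 2 = i. ?f T))"
    by (simp add: sum_distrib_left)
  finally show ?thesis by (simp only: sum_fixed_ee q_def)
qed

section \<open>Trees with at most one even-degree node on odd levels\<close>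

fun broom :: "nat \<Rightarrow> nat \<Rightarrow> nat list \<Rightarrow> ptree" where
  "broom (Suc d) a (x # xs) = Node a [broom d x xs]"
| "broom d a xs = Node a (map (\<lambda>x. Node x []) xs)"

lemma label_broom [simp]: "label (broom d a xs) = a"
  by (cases "(d, a, xs)" rule: broom.cases) auto

lemma sum_list_singleton_mset: "(\<Sum>x\<leftarrow>xs. {#x#}) = mset xs"
  by (induction xs) auto

lemma broom_0: "broom 0 a xs = Node a (map (\<lambda>x. Node x []) xs)"
  by (cases xs) auto

lemma labels_broom: "labels (broom d a xs) = mset (a # xs)"
  by (induction d a xs rule: broom.induct) (auto simp: comp_def sum_list_singleton_mset)

lemma weakly_increasing_broom: "sorted (a # xs) \<Longrightarrow> weakly_increasing (broom d a xs)"
  by (induction d a xs rule: broom.induct) (auto simp: comp_def)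

lemma broom_wi_trees: "broom d 0 (sorted_list_of_multiset M) \<in> wi_trees M"
  by (simp add: wi_trees_def labels_broom weakly_increasing_broom)

text \<open>The path nodes on levels below \<open>d\<close> have degree one. The node on the odd
  level \<open>d\<close> has degree \<open>k\<close>, and its \<open>k\<close> leaves lie on an even
  level.\<close>

lemma broom_ee_oe:
  assumes "odd d" "length xs = d + k"
  shows "ee (broom d a xs) = k \<and> oe (broom d a xs) = of_bool (even k)"
  using assms
proof (induction d arbitrary: a xs rule: less_induct)
  case (less d)
  have leaf: "ee (Node b []) = 1" "oe (Node b []) = 0" for b
    by (simp_all add: ee_Node oe_Node)
  show ?case
  proof (cases "d = 1")
    case True
    then obtain x ys where "xs = x # ys" "length ys = k" using less(3) by (cases xs) auto
    with True show ?thesis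
      by (simp add: broom_0 ee_Node oe_Node leaf comp_def sum_list_triv)
  next
    case False
    with less(2) obtain d' where d: "d = Suc (Suc d')" "odd d'"
      by (metis One_nat_def even_Suc nat.exhaust odd_pos less_irrefl)
    then obtain x y ys where xs: "xs = x # y # ys" "length ys = d' + k"
      using less(3) by (auto simp: length_Suc_conv)
    show ?thesis using less(1)[of d' ys y] d xs by (simp add: ee_Node oe_Node)
  qed
qed

lemma exists_oe_half_0:
  assumes "T \<in> wi_trees M"
  shows "\<exists>T' \<in> wi_trees M. ee T' div 2 = ee T div 2 \<and> oe T' div 2 = 0"
proof -
  \<comment> \<open>The parity summand makes \<open>p - k\<close> odd, as the broom requires, and
    disappears in \<open>k div 2 = i\<close>.\<close>
  define i p k where "i = ee T div 2" and "p = size M" and "k = 2 * i + of_bool (even p)"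
  have ip: "i \<le> p div 2" using wi_trees_halves(3)[OF assms] by (simp add: i_def p_def)
  show ?thesis
  \<comment> \<open>In this case \<open>k\<close> would exceed \<open>p\<close>, but
    \<open>T\<close> itself is a witness since \<open>ee T div 2\<close> exhausts the sum of the
    halves.\<close>
  proof (cases "even p \<and> i = p div 2")
    case True
    then have "oe T div 2 = 0"
      using halves_sum[OF size_labels_wi_trees[OF assms]] by (simp add: i_def p_def)
    then show ?thesis using assms by blast
  next
    case False
    have k: "k < p" "odd (p - k)"
    proof -
      show "k < p" using ip False by (cases "even p") (auto simp: k_def elim!: evenE oddE)
      then show "odd (p - k)" by (cases "even p") (auto simp: k_def)
    qed
    have "length (sorted_list_of_multiset M) = p - k + k"
      using k by (simp add: p_def flip: size_mset)
    from broom_ee_oe[OF k(2) this, of 0] broom_wi_trees[of "p - k" M] show ?thesis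
      by (intro bexI[of _ "broom (p - k) 0 (sorted_list_of_multiset M)"])
        (auto simp: k_def i_def)
  qed
qed

text \<open>If \<open>oe T' div 2\<close> vanishes, then so do \<open>excess T'\<close> and
  \<open>eact T'\<close>, and \<open>T'\<close> is counted for \<open>j = 0\<close>.\<close>

lemma gamma_hat_0_pos:
  assumes "T \<in> wi_trees M"
  shows "gamma_hat M (ee T div 2) 0 > 0"
proof -
  obtain T' where T': "T' \<in> wi_trees M" "ee T' div 2 = ee T div 2" "oe T' div 2 = 0"
    using exists_oe_half_0[OF assms] by blast
  then have "T' \<in> trees_with M (ee T div 2) (size M div 2 - ee T div 2 - 2 * 0) 0"
    using wi_trees_halves[OF T'(1)] by (auto simp: trees_with_def)
  then show ?thesis
    using wi_trees_halves(3)[OF assms]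
    by (subst gamma_hat_trees_with) (auto simp: card_gt_0_iff finite_trees_with simp del: diff_is_0_eq)
qed

section \<open>Evaluation of the coefficients in \<open>x\<close>, and gamma-positive
  polynomials\<close>

lemma eval_yz_add: "eval_yz (p + q) b c = eval_yz p b c + eval_yz q b c"
proof -
  have 1: "map_poly of_int (r + s) = map_poly of_int r + (map_poly of_int s :: 'a poly)" for r s
    by (rule poly_eqI) (simp add: coeff_map_poly)
  show ?thesis
    unfolding eval_yz_def
    by (subst poly_add[symmetric], rule arg_cong[where f = "\<lambda>p. poly p b"])
      (rule poly_eqI, simp add: coeff_map_poly 1)
qed

lemma eval_yz_0: "eval_yz 0 b c = 0"
  by (simp add: eval_yz_def)

lemma eval_yz_sum: "eval_yz (\<Sum>t\<in>A. f t) b c = (\<Sum>t\<in>A. eval_yz (f t) b c)"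
  by (induction A rule: infinite_finite_induct) (simp_all add: eval_yz_0 eval_yz_add)

lemma eval_yz_monom: "eval_yz (monom (monom 1 n) m) b c = b ^ m * c ^ n"
  by (simp add: eval_yz_def map_poly_monom poly_monom mult.commute)

lemma XYZ_monom: "X ^ i * Y ^ m * Z ^ n = monom (monom (monom 1 n) m) i"
  by (simp add: X_def Y_def Z_def poly_const_pow monom_altdef ac_simps)

lemma eval_S_hat_coeff:
  "eval_yz (S_hat_coeff M i) b c =
    (\<Sum>T | T \<in> wi_trees M \<and> ee T div 2 = i. b ^ (oe T div 2) * c ^ (odd_nodes T div 2))"
proof -
  have "S_hat_coeff M i = (\<Sum>T\<in>wi_trees M. if ee T div 2 = i
      then monom (monom 1 (odd_nodes T div 2)) (oe T div 2) else 0)"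
    unfolding S_hat_coeff_def S_hat_def XYZ_monom by (simp add: coeff_sum)
  also have "\<dots> = (\<Sum>T | T \<in> wi_trees M \<and> ee T div 2 = i.
      monom (monom 1 (odd_nodes T div 2)) (oe T div 2))"
    by (simp add: sum.inter_filter finite_wi_trees)
  finally show ?thesis by (simp add: eval_yz_sum eval_yz_monom)
qed

text \<open>The coefficients of each summand are symmetric about \<open>n / 2\<close> and increase
  up to there, and nonnegative combinations inherit both. Positivity of \<open>g 0\<close> makes the
  degree exactly \<open>n\<close>, so that the centre of symmetry is half the degree.\<close>

lemma gamma_positive_palindromic_unimodal:
  fixes g :: "nat \<Rightarrow> nat" and n :: nat
  defines "h \<equiv> (\<Sum>j | 2 * j \<le> n. of_nat (g j) * [:0, 1:] ^ j * [:1, 1:] ^ (n - 2 * j) :: int poly)"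
  assumes "g 0 > 0"
  shows "palindromic h \<and> unimodal h"
proof -
  let ?J = "{j. 2 * j \<le> n}"
  \<comment> \<open>Without the case distinction, truncation would turn the entries with
    \<open>k < j\<close> into \<open>choose 0\<close>, which is 1.\<close>
  let ?b = "\<lambda>j k. if j \<le> k then (n - 2 * j) choose (k - j) else 0"
  have finJ: "finite ?J" using finite_gamma_indices[of 0 n] by simp
  have binom: "coeff ([:1, 1:] ^ m :: int poly) k = int (m choose k)" for m k
    by (cases "k \<le> m")
      (simp_all add: coeff_linear_poly_power coeff_eq_0 degree_linear_power binomial_eq_0)
  have coeff: "coeff h k = (\<Sum>j\<in>?J. int (g j) * int (?b j k))" for k
  proof -
    have "of_nat (g j) * [:0, 1:] ^ j * [:1, 1:] ^ m =
        smult (int (g j)) (monom 1 j * [:1, 1:] ^ m)" for j m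
      by (simp add: monom_altdef of_nat_poly)
    then show ?thesis
      by (auto simp: h_def coeff_sum coeff_monom_mult binom intro!: sum.cong)
  qed
  have sym: "coeff h k = coeff h (n - k)" if "k \<le> n" for k
    unfolding coeff
  proof (intro sum.cong refl arg_cong2[where f = "(*)"] arg_cong[where f = int])
    fix j assume j: "j \<in> ?J"
    show "?b j k = ?b j (n - k)"
    proof (cases "j \<le> k \<and> j \<le> n - k")
      case True
      then have "n - 2 * j - (k - j) = n - k - j" "k - j \<le> n - 2 * j" using that j by auto
      with True show ?thesis using binomial_symmetric[of "k - j" "n - 2 * j"] by simp
    \<comment> \<open>If \<open>j > k\<close>, the left side is 0 by definition and the right side
      has a lower index \<open>n - k - j\<close> above \<open>n - 2 * j\<close>, or is 0 by
      definition as well; \<open>j > n - k\<close> is the mirror case.\<close>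
    qed (use that j in auto)
  qed
  have mono: "coeff h k \<le> coeff h (Suc k)" if "k < n div 2" for k
    unfolding coeff
  proof (intro sum_mono mult_left_mono)
    fix j assume "j \<in> ?J"
    then show "int (?b j k) \<le> int (?b j (Suc k))"
      using that by (auto intro!: binomial_mono)
  qed simp
  have deg: "degree h = n"
  proof (rule antisym)
    show "degree h \<le> n"
      by (rule degree_le) (auto simp: coeff intro!: sum.neutral)
    have "0 < int (g 0) * int (?b 0 n)" using assms by simp
    also have "\<dots> \<le> coeff h n"
      unfolding coeff by (rule member_le_sum) (use finJ in auto)
    finally show "n \<le> degree h" by (intro le_degree) simp
  qed
  \<comment> \<open>Reflection turns the descent into the ascent \<open>mono\<close>, except at the
    two central coefficients for odd \<open>n\<close>, which are mirror images of each other and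
    hence equal.\<close>
  have "coeff h (Suc k) \<le> coeff h k" if "n div 2 \<le> k" "k < n" for k
  proof (cases "n - Suc k < n div 2")
    case True
    then have "coeff h (n - Suc k) \<le> coeff h (Suc (n - Suc k))" by (rule mono)
    moreover have "Suc (n - Suc k) = n - k" using that by simp
    ultimately show ?thesis using sym[of k] sym[of "Suc k"] that by simp
  next
    case False
    then have "n - Suc k = k" using that by linarith
    then show ?thesis using sym[of "Suc k"] that by simp
  qed
  then have "unimodal h"
    unfolding unimodal_def deg using mono by (intro exI[of _ "n div 2"]) auto
  then show ?thesis unfolding palindromic_def deg using sym by blast
qed

theorem theorem1p7:
  fixes n :: nat and ps :: "nat \<Rightarrow> nat" and M :: "nat multiset" and p :: nat
  assumes "\<forall>i\<in>{1..n}. ps i > 0"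
    and "M = (\<Sum>i=1..n. replicate_mset (ps i) i)"
    and "p = (\<Sum>i=1..n. ps i)"
  shows "S_hat M X Y Z =
      (\<Sum>i\<le>p div 2. X ^ i * (\<Sum>j | i + 2 * j \<le> p div 2.
         of_nat (gamma_hat M i j) * (Y * Z) ^ j * (Y + Z) ^ (p div 2 - i - 2 * j)))
    \<and> S_hat M X Y Z = S_hat M X Z Y
    \<and> (\<forall>i. eval_yz (S_hat_coeff M i) [:0, 1:] 1 = (eval_yz (S_hat_coeff M i) 1 [:0, 1:] :: int poly)
         \<and> palindromic (eval_yz (S_hat_coeff M i) [:0, 1:] 1)
         \<and> unimodal (eval_yz (S_hat_coeff M i) [:0, 1:] 1))"
proof -
  have p: "size M = p" by (simp add: assms(2,3))
  have "eval_yz (S_hat_coeff M i) [:0, 1:] 1 = (eval_yz (S_hat_coeff M i) 1 [:0, 1:] :: int poly)" for i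
    unfolding eval_S_hat_coeff sum_fixed_ee by (simp add: add.commute)
  moreover have "palindromic (eval_yz (S_hat_coeff M i) [:0, 1:] 1) \<and>
      unimodal (eval_yz (S_hat_coeff M i) [:0, 1:] 1)" for i
  \<comment> \<open>If some tree attains \<open>i\<close>, the term for \<open>j = 0\<close> is
    present and fixes the degree. Otherwise the coefficient is the zero polynomial.\<close>
  proof (cases "\<exists>T\<in>wi_trees M. ee T div 2 = i")
    case True
    then have i: "i \<le> size M div 2" and g: "gamma_hat M i 0 > 0"
      using wi_trees_halves(3) gamma_hat_0_pos by fastforce+
    \<comment> \<open>At \<open>z = 1\<close> the factors \<open>y * z\<close> and
      \<open>y + z\<close> become \<open>[:0, 1:]\<close> and \<open>[:1, 1:]\<close>.\<close>
    have "eval_yz (S_hat_coeff M i) [:0, 1:] 1 = (\<Sum>j | 2 * j \<le> size M div 2 - i.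
        of_nat (gamma_hat M i j) * [:0, 1:] ^ j * [:1, 1:] ^ (size M div 2 - i - 2 * j) :: int poly)"
      unfolding eval_S_hat_coeff sum_fixed_ee using i
      by (intro sum.cong) (auto simp: one_pCons)
    then show ?thesis
      by (simp only: gamma_positive_palindromic_unimodal[of "gamma_hat M i", OF g] simp_thms)
  next
    case False
    then have "eval_yz (S_hat_coeff M i) [:0, 1:] 1 = (0 :: int poly)"
      unfolding eval_S_hat_coeff by (intro sum.neutral) auto
    then show ?thesis by (simp add: palindromic_def unimodal_def)
  qed
  ultimately show ?thesis
    using p S_hat_expansion[of M X Y Z] S_hat_expansion[of M X Z Y]
    by (simp add: mult.commute[of Z Y] add.commute[of Z Y])
qed

end
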